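(* Let $h>0$ be an integer, $\beta>0$, and $\{J_e\}_{e\in E}$ fixed real numbers. Let $T=(V,E)$ be an arbitrary finite tree of height $h$ rooted at $r$, and let $\Lambda$ be the set of vertices at distance $h$ from $r$. Let $\mu$ be the Gibbs distribution on $T$ with these couplings, and let $\mu_h$ be its marginal on $\Lambda$. Then $$\|\mu_h(\cdot\mid\sigma(r)=+1)-\mu_h(\cdot\mid\sigma(r)=-1)\|_{\rm TV}\le\sqrt{\sum_{v\in\Lambda}\prod_{e\in\mathrm{path}(r,v)}\Gamma_e^2}.$$
   Context: The Gibbs distribution $\mu$ on $\{\pm1\}^V$ is $$\mu(\sigma)\propto\exp\Big(\beta\sum_{\{u,w\}\in E}\mathbf{1}\{\sigma(u)=\sigma(w)\}J_{\{u,w\}}\Big).$$ For each edge $e$, the influence is $\Gamma_e=\frac{|1-\exp(\beta J_e)|}{1+\exp(\beta J_e)}$. For vertices $u,v$, $\mathrm{path}(u,v)$ denotes the set of edges on the unique path from $u$ to $v$. *)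

theory Defs
  imports "HOL-Probability.Probability"
begin

text \<open>
  Finite simple undirected graphs are given by a vertex set \<open>V\<close> and a set \<open>E\<close> of two-element
  vertex sets. The trees of the AFP entry \<open>Graph_Theory\<close> are not used: there, being a
  forest only excludes directed cycles, which is the wrong notion for undirected graphs.
\<close>

definition simple_graph :: "'a set \<Rightarrow> 'a set set \<Rightarrow> bool" where
  "simple_graph V E \<longleftrightarrow> finite V \<and> (\<forall>e\<in>E. e \<subseteq> V \<and> card e = 2)"

definition walk :: "'a set \<Rightarrow> 'a set set \<Rightarrow> 'a \<Rightarrow> 'a list \<Rightarrow> 'a \<Rightarrow> bool" where
  "walk V E u p v \<longleftrightarrow> p \<noteq> [] \<and> hd p = u \<and> last p = v \<and> set p \<subseteq> V \<and>
     successively (\<lambda>x y. {x, y} \<in> E) p"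

definition simple_path :: "'a set \<Rightarrow> 'a set set \<Rightarrow> 'a \<Rightarrow> 'a list \<Rightarrow> 'a \<Rightarrow> bool" where
  "simple_path V E u p v \<longleftrightarrow> walk V E u p v \<and> distinct p"

definition graph_connected :: "'a set \<Rightarrow> 'a set set \<Rightarrow> bool" where
  "graph_connected V E \<longleftrightarrow> V \<noteq> {} \<and> (\<forall>u\<in>V. \<forall>v\<in>V. \<exists>p. walk V E u p v)"

text \<open>A cycle is listed without repeating its starting vertex.\<close>

definition graph_cycle :: "'a set \<Rightarrow> 'a set set \<Rightarrow> 'a list \<Rightarrow> bool" where
  "graph_cycle V E c \<longleftrightarrow> length c \<ge> 3 \<and> simple_path V E (hd c) c (last c) \<and> {last c, hd c} \<in> E"

definition finite_tree :: "'a set \<Rightarrow> 'a set set \<Rightarrow> bool" where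
  "finite_tree V E \<longleftrightarrow> simple_graph V E \<and> graph_connected V E \<and> (\<nexists>c. graph_cycle V E c)"

definition graph_dist :: "'a set \<Rightarrow> 'a set set \<Rightarrow> 'a \<Rightarrow> 'a \<Rightarrow> nat" where
  "graph_dist V E u v = (LEAST n. \<exists>p. walk V E u p v \<and> length p = Suc n)"

definition tree_height :: "'a set \<Rightarrow> 'a set set \<Rightarrow> 'a \<Rightarrow> nat" where
  "tree_height V E r = Max (graph_dist V E r ` V)"

definition level :: "'a set \<Rightarrow> 'a set set \<Rightarrow> 'a \<Rightarrow> nat \<Rightarrow> 'a set" where
  "level V E r h = {v \<in> V. graph_dist V E r v = h}"

definition edges_of :: "'a list \<Rightarrow> 'a set set" where
  "edges_of p = {{p ! i, p ! Suc i} |i. Suc i < length p}"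

definition path_edges :: "'a set \<Rightarrow> 'a set set \<Rightarrow> 'a \<Rightarrow> 'a \<Rightarrow> 'a set set" where
  "path_edges V E u v = edges_of (THE p. simple_path V E u p v)"

text \<open>Configurations in \<open>{\<plusminus>1}\<^sup>V\<close> are extensional functions, with value \<open>undefined\<close> outside \<open>V\<close>.\<close>

definition configs :: "'a set \<Rightarrow> ('a \<Rightarrow> int) set" where
  "configs V = V \<rightarrow>\<^sub>E {- 1, 1}"

text \<open>For \<open>e = {u, w}\<close> the bounded quantifiers say that \<open>\<sigma> u = \<sigma> w\<close>.\<close>

definition gibbs_weight :: "'a set set \<Rightarrow> real \<Rightarrow> ('a set \<Rightarrow> real) \<Rightarrow> ('a \<Rightarrow> int) \<Rightarrow> real" where
  "gibbs_weight E \<beta> J \<sigma> = exp (\<beta> * (\<Sum>e\<in>E. of_bool (\<forall>u\<in>e. \<forall>w\<in>e. \<sigma> u = \<sigma> w) * J e))"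

definition partition_function :: "'a set \<Rightarrow> 'a set set \<Rightarrow> real \<Rightarrow> ('a set \<Rightarrow> real) \<Rightarrow> real" where
  "partition_function V E \<beta> J = (\<Sum>\<sigma>\<in>configs V. gibbs_weight E \<beta> J \<sigma>)"

definition gibbs :: "'a set \<Rightarrow> 'a set set \<Rightarrow> real \<Rightarrow> ('a set \<Rightarrow> real) \<Rightarrow> ('a \<Rightarrow> int) pmf" where
  "gibbs V E \<beta> J = embed_pmf (\<lambda>\<sigma>. if \<sigma> \<in> configs V
     then gibbs_weight E \<beta> J \<sigma> / partition_function V E \<beta> J else 0)"

definition marginal_given_spin ::
  "('a \<Rightarrow> int) pmf \<Rightarrow> 'a set \<Rightarrow> 'a \<Rightarrow> int \<Rightarrow> ('a \<Rightarrow> int) pmf" where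
  "marginal_given_spin \<mu> \<Lambda> r s = map_pmf (\<lambda>\<sigma>. restrict \<sigma> \<Lambda>) (cond_pmf \<mu> {\<sigma>. \<sigma> r = s})"

definition tv_dist :: "'b pmf \<Rightarrow> 'b pmf \<Rightarrow> real" where
  "tv_dist p q = (SUP A. \<bar>measure_pmf.prob p A - measure_pmf.prob q A\<bar>)"

definition influence :: "real \<Rightarrow> ('a set \<Rightarrow> real) \<Rightarrow> 'a set \<Rightarrow> real" where
  "influence \<beta> J e = \<bar>1 - exp (\<beta> * J e)\<bar> / (1 + exp (\<beta> * J e))"

lemma finite_configs: "finite V \<Longrightarrow> finite (configs V)"
  unfolding configs_def by (intro finite_PiE) auto

lemma partition_function_pos:
  assumes "finite V"
  shows "partition_function V E \<beta> J > 0"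
proof -
  have "(\<lambda>v\<in>V. 1) \<in> configs V"
    by (simp add: configs_def)
  then show ?thesis
    unfolding partition_function_def
    by (intro sum_pos finite_configs assms) (auto simp: gibbs_weight_def)
qed

text \<open>The function embedded in the definition of \<open>gibbs\<close> is a probability mass function.\<close>

lemma pmf_gibbs:
  assumes "finite V"
  shows "pmf (gibbs V E \<beta> J) \<sigma> = (if \<sigma> \<in> configs V
           then gibbs_weight E \<beta> J \<sigma> / partition_function V E \<beta> J else 0)"
proof -
  let ?f = "\<lambda>\<sigma>. if \<sigma> \<in> configs V then gibbs_weight E \<beta> J \<sigma> / partition_function V E \<beta> J else 0"
  note Z = partition_function_pos[OF assms, of E \<beta> J]
  have nonneg: "0 \<le> ?f \<tau>" for \<tau>
    using Z by (simp add: gibbs_weight_def)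
  have "(\<integral>\<^sup>+\<tau>. ennreal (?f \<tau>) \<partial>count_space UNIV) = (\<Sum>\<tau>\<in>configs V. ennreal (?f \<tau>))"
    by (rule nn_integral_count_space'[OF finite_configs[OF assms]]) auto
  also have "\<dots> = ennreal (\<Sum>\<tau>\<in>configs V. ?f \<tau>)"
    by (rule sum_ennreal) (rule nonneg)
  also have "(\<Sum>\<tau>\<in>configs V. ?f \<tau>) = 1"
    using Z by (simp add: partition_function_def flip: sum_divide_distrib)
  finally show ?thesis
    unfolding gibbs_def using nonneg by (subst pmf_embed_pmf) auto
qed

lemma set_pmf_gibbs:
  assumes "finite V"
  shows "set_pmf (gibbs V E \<beta> J) = configs V"
  using partition_function_pos[OF assms, of E \<beta> J]
  by (auto simp: set_pmf_eq pmf_gibbs[OF assms] gibbs_weight_def split: if_splits)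

text \<open>The conditioning in \<open>marginal_given_spin\<close> is on an event of positive probability.\<close>

lemma gibbs_spin_nonempty:
  assumes "finite V" "r \<in> V" "s \<in> {- 1, 1}"
  shows "set_pmf (gibbs V E \<beta> J) \<inter> {\<sigma>. \<sigma> r = s} \<noteq> {}"
proof -
  have "(\<lambda>v\<in>V. s) \<in> set_pmf (gibbs V E \<beta> J) \<inter> {\<sigma>. \<sigma> r = s}"
    using assms by (auto simp: set_pmf_gibbs configs_def)
  then show ?thesis by blast
qed

end

theory Submission
  imports Defs
begin

text \<open>
  For a set \<open>S\<close> of observed vertices let \<open>F\<close> and \<open>G\<close> be the (unnormalised) laws of the spins on
  \<open>S\<close> given root spin \<open>+1\<close> and \<open>-1\<close>. By Cauchy--Schwarz the squared total variation distance is
  bounded by the triangular discrimination, the normalised sum of \<open>(F - G)\<^sup>2 / (F + G)\<close>. Passing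
  through an edge multiplies this quantity by exactly \<open>\<Gamma>\<^sub>e\<^sup>2\<close>. Glueing two trees at the root multiplies
  the two pairs of laws, and the discrimination is subadditive under such products when one factor
  is symmetric under the global spin flip: with biases \<open>x, y \<in> [-1, 1]\<close> this reduces to
  \<open>(x + y)\<^sup>2 / (1 + x y) + (x - y)\<^sup>2 / (1 - x y) \<le> 2 (x\<^sup>2 + y\<^sup>2)\<close>. Every rooted tree arises from single
  vertices by joining two trees with an edge between their roots, so the bound, for all \<open>S\<close>
  at once, follows by induction.
\<close>

section \<open>Rooted trees and their paths\<close>

text \<open>Rule \<open>join\<close> hangs one child subtree below \<open>r\<close>, which keeps the
  children it already has. An induction step thus deals with one edge and one product of two laws,
  whatever the degree of the root.\<close>

inductive rooted_tree :: "'a set \<Rightarrow> 'a set set \<Rightarrow> 'a \<Rightarrow> bool" where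
  singleton: "rooted_tree {r} {} r"
| join: "rooted_tree V\<^sub>1 E\<^sub>1 r \<Longrightarrow> rooted_tree V\<^sub>2 E\<^sub>2 c \<Longrightarrow> V\<^sub>1 \<inter> V\<^sub>2 = {} \<Longrightarrow>
    rooted_tree (V\<^sub>1 \<union> V\<^sub>2) (insert {r, c} (E\<^sub>1 \<union> E\<^sub>2)) r"

lemma rooted_tree_root: "rooted_tree V E r \<Longrightarrow> r \<in> V"
  by (induction rule: rooted_tree.induct) auto

lemma rooted_tree_simple_graph: "rooted_tree V E r \<Longrightarrow> simple_graph V E"
proof (induction rule: rooted_tree.induct)
  case (singleton r)
  then show ?case by (simp add: simple_graph_def)
next
  case (join V\<^sub>1 E\<^sub>1 r V\<^sub>2 E\<^sub>2 c)
  have "r \<in> V\<^sub>1" "c \<in> V\<^sub>2"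
    using join.hyps by (simp_all add: rooted_tree_root)
  moreover from this have "r \<noteq> c"
    using join.hyps by auto
  ultimately show ?case using join.IH by (auto simp: simple_graph_def)
qed

lemma rooted_tree_finite: "rooted_tree V E r \<Longrightarrow> finite V"
  by (induction rule: rooted_tree.induct) auto

lemma rooted_tree_edges_subset: "rooted_tree V E r \<Longrightarrow> E \<subseteq> Pow V"
  by (drule rooted_tree_simple_graph) (auto simp: simple_graph_def)

lemma rooted_tree_finite_edges: "rooted_tree V E r \<Longrightarrow> finite E"
  by (induction rule: rooted_tree.induct) auto

text \<open>The leaf is added to the side that contains \<open>p\<close>, and the join is then
  repeated. This makes it possible to build a rooted tree by exploring a graph outwards, although
  \<open>join\<close> itself attaches whole subtrees.\<close>

lemma rooted_tree_add_leaf: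
  "rooted_tree V E r \<Longrightarrow> p \<in> V \<Longrightarrow> v \<notin> V \<Longrightarrow> rooted_tree (insert v V) (insert {p, v} E) r"
proof (induction rule: rooted_tree.induct)
  case (singleton r)
  then show ?case
    using rooted_tree.join[OF rooted_tree.singleton[of r] rooted_tree.singleton[of v]]
    by (auto simp: insert_commute)
next
  case (join V\<^sub>1 E\<^sub>1 r V\<^sub>2 E\<^sub>2 c)
  show ?case
  proof (cases "p \<in> V\<^sub>1")
    case True
    then have "rooted_tree (insert v V\<^sub>1) (insert {p, v} E\<^sub>1) r"
      using join by auto
    then have "rooted_tree (insert v V\<^sub>1 \<union> V\<^sub>2) (insert {r, c} (insert {p, v} E\<^sub>1 \<union> E\<^sub>2)) r"
      using join by (intro rooted_tree.join) auto
    then show ?thesis by (simp add: insert_commute)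
  next
    case False
    then have "rooted_tree (insert v V\<^sub>2) (insert {p, v} E\<^sub>2) c"
      using join by auto
    then have "rooted_tree (V\<^sub>1 \<union> insert v V\<^sub>2) (insert {r, c} (E\<^sub>1 \<union> insert {p, v} E\<^sub>2)) r"
      using join by (intro rooted_tree.join) auto
    then show ?thesis by (simp add: insert_commute)
  qed
qed

section \<open>Existence of simple paths in rooted trees\<close>

lemma simple_path_mono:
  "simple_path V E u p v \<Longrightarrow> V \<subseteq> V' \<Longrightarrow> E \<subseteq> E' \<Longrightarrow> simple_path V' E' u p v"
  unfolding simple_path_def walk_def using successively_mono[of "\<lambda>x y. {x, y} \<in> E" p "\<lambda>x y. {x, y} \<in> E'"]
  by blast

lemma simple_path_append:
  assumes "simple_path V E u p x" "simple_path V E y q v" "{x, y} \<in> E" "set p \<inter> set q = {}"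
  shows "simple_path V E u (p @ q) v"
  using assms by (auto simp: simple_path_def walk_def successively_append_iff)

text \<open>A path between the two sides crosses the new edge once. Both endpoints are arbitrary,
  since the cycle argument below has to connect two neighbours of an outside vertex.\<close>

lemma rooted_tree_ex_simple_path:
  "rooted_tree V E r \<Longrightarrow> u \<in> V \<Longrightarrow> v \<in> V \<Longrightarrow> \<exists>p. simple_path V E u p v"
proof (induction arbitrary: u v rule: rooted_tree.induct)
  case (singleton r)
  then have "simple_path {r} {} u [r] v" by (simp add: simple_path_def walk_def)
  then show ?case by blast
next
  case (join V\<^sub>1 E\<^sub>1 r V\<^sub>2 E\<^sub>2 c)
  let ?V = "V\<^sub>1 \<union> V\<^sub>2" and ?E = "insert {r, c} (E\<^sub>1 \<union> E\<^sub>2)"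
  have root: "r \<in> V\<^sub>1" "c \<in> V\<^sub>2" using join.hyps by (simp_all add: rooted_tree_root)
  have 1: "\<exists>p. simple_path ?V ?E u p v \<and> set p \<subseteq> V\<^sub>1" if uv: "u \<in> V\<^sub>1" "v \<in> V\<^sub>1" for u v
  proof -
    obtain p where p: "simple_path V\<^sub>1 E\<^sub>1 u p v" using join.IH(1) uv by blast
    have "simple_path ?V ?E u p v" using p by (rule simple_path_mono) auto
    moreover have "set p \<subseteq> V\<^sub>1" using p by (simp add: simple_path_def walk_def)
    ultimately show ?thesis by blast
  qed
  have 2: "\<exists>p. simple_path ?V ?E u p v \<and> set p \<subseteq> V\<^sub>2" if uv: "u \<in> V\<^sub>2" "v \<in> V\<^sub>2" for u v
  proof -
    obtain p where p: "simple_path V\<^sub>2 E\<^sub>2 u p v" using join.IH(2) uv by blast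
    have "simple_path ?V ?E u p v" using p by (rule simple_path_mono) auto
    moreover have "set p \<subseteq> V\<^sub>2" using p by (simp add: simple_path_def walk_def)
    ultimately show ?thesis by blast
  qed
  have edge: "{r, c} \<in> ?E" "{c, r} \<in> ?E" by auto
  have 12: "\<exists>p. simple_path ?V ?E u p v" if uv: "u \<in> V\<^sub>1" "v \<in> V\<^sub>2" for u v
  proof -
    obtain p q where "simple_path ?V ?E u p r" "set p \<subseteq> V\<^sub>1" "simple_path ?V ?E c q v" "set q \<subseteq> V\<^sub>2"
      using 1[of u r] 2[of c v] root uv by blast
    then have "simple_path ?V ?E u (p @ q) v"
      using \<open>V\<^sub>1 \<inter> V\<^sub>2 = {}\<close> edge by (intro simple_path_append[of _ _ _ _ r c]) auto
    then show ?thesis by blast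
  qed
  have 21: "\<exists>p. simple_path ?V ?E u p v" if uv: "u \<in> V\<^sub>2" "v \<in> V\<^sub>1" for u v
  proof -
    obtain p q where "simple_path ?V ?E u p c" "set p \<subseteq> V\<^sub>2" "simple_path ?V ?E r q v" "set q \<subseteq> V\<^sub>1"
      using 2[of u c] 1[of r v] root uv by blast
    then have "simple_path ?V ?E u (p @ q) v"
      using \<open>V\<^sub>1 \<inter> V\<^sub>2 = {}\<close> edge by (intro simple_path_append[of _ _ _ _ c r]) auto
    then show ?thesis by blast
  qed
  show ?case using join.prems 1 2 12 21 by blast
qed

section \<open>Finite trees as rooted trees, and unique paths from the root\<close>

lemma successively_set_subset:
  assumes "successively R p" "p \<noteq> []" "hd p \<in> W"
    "\<And>x y. R x y \<Longrightarrow> x \<in> set p \<Longrightarrow> y \<in> set p \<Longrightarrow> x \<in> W \<Longrightarrow> y \<in> W"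
  shows "set p \<subseteq> W"
  using assms
proof (induction p rule: induct_list012)
  case (3 x y p)
  have "y \<in> W" using "3.prems"(4)[of x y] "3.prems"(1,3) by simp
  then have "set (y # p) \<subseteq> W"
    using "3.prems"(1,4) by (intro "3.IH"(2)) simp_all
  then show ?case using "3.prems"(3) by simp
qed auto

text \<open>Choose a maximal vertex set whose induced subgraph is a rooted tree with root
  \<open>r\<close>. If it missed a vertex, connectedness would give an edge leaving it, and
  acyclicity would make the outer endpoint of that edge a leaf that can be added.\<close>

lemma finite_tree_imp_rooted_tree:
  assumes tree: "finite_tree V E" and r: "r \<in> V"
  shows "rooted_tree V E r"
proof -
  have fin: "finite V" and edge: "\<And>e. e \<in> E \<Longrightarrow> e \<subseteq> V \<and> card e = 2"
    and conn: "\<And>u v. u \<in> V \<Longrightarrow> v \<in> V \<Longrightarrow> \<exists>p. walk V E u p v"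
    and acyclic: "\<And>c. \<not> graph_cycle V E c"
    using tree by (auto simp: finite_tree_def simple_graph_def graph_connected_def)
  define subtrees where "subtrees = {W. W \<subseteq> V \<and> rooted_tree W {e \<in> E. e \<subseteq> W} r}"
  have "{e \<in> E. e \<subseteq> {r}} = {}"
    using edge by (fastforce simp: subset_singleton_iff)
  then have "{r} \<in> subtrees"
    using r rooted_tree.singleton[of r] by (simp only: subtrees_def mem_Collect_eq) simp
  moreover have "finite subtrees"
    using fin by (auto simp: subtrees_def intro: finite_subset[of _ "Pow V"])
  ultimately obtain W where W: "W \<in> subtrees" and maximal: "\<And>W'. W' \<in> subtrees \<Longrightarrow> W \<subseteq> W' \<Longrightarrow> W = W'"
    using finite_has_maximal[of subtrees] by blast
  have WV: "W \<subseteq> V" and rt: "rooted_tree W {e \<in> E. e \<subseteq> W} r"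
    using W by (auto simp: subtrees_def)
  have "W = V"
  proof (rule ccontr)
    assume "W \<noteq> V"
    then obtain u where u: "u \<in> V" "u \<notin> W" using WV by blast
    obtain l where l: "walk V E r l u" using conn[OF r u(1)] by blast
    \<comment> \<open>Otherwise \<open>W\<close> is closed under adjacency, and the walk
      \<open>l\<close> from \<open>r\<close> could not reach \<open>u\<close>.\<close>
    have "\<exists>p v. {p, v} \<in> E \<and> p \<in> W \<and> v \<notin> W"
    proof (rule ccontr)
      assume "\<nexists>p v. {p, v} \<in> E \<and> p \<in> W \<and> v \<notin> W"
      then have "set l \<subseteq> W"
        using l rooted_tree_root[OF rt]
        by (intro successively_set_subset[where R = "\<lambda>x y. {x, y} \<in> E"]) (auto simp: walk_def)
      moreover have "u \<in> set l" using l by (auto simp: walk_def)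
      ultimately show False using u by blast
    qed
    then obtain p v where pv: "{p, v} \<in> E" "p \<in> W" "v \<notin> W" by blast
    have vV: "v \<in> V" using edge pv by blast
    \<comment> \<open>A second neighbour \<open>q\<close> of \<open>v\<close> in \<open>W\<close>
      would close a cycle: the path from \<open>p\<close> to \<open>q\<close> inside
      \<open>W\<close>, followed by \<open>v\<close>.\<close>
    have only: "q = p" if q: "{q, v} \<in> E" "q \<in> W" for q
    proof (rule ccontr)
      assume "q \<noteq> p"
      obtain l where l: "simple_path W {e \<in> E. e \<subseteq> W} p l q"
        using rooted_tree_ex_simple_path[OF rt pv(2) q(2)] by blast
      have lE: "simple_path V E p l q"
        using l by (rule simple_path_mono) (use WV in auto)
      have "simple_path V E p (l @ [v]) v"
        using lE vV q(1) l pv(3)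
        by (intro simple_path_append[of _ _ _ _ q v]) (auto simp: simple_path_def walk_def)
      moreover have "length l \<ge> 2"
        using lE \<open>q \<noteq> p\<close> by (cases l; cases "tl l") (auto simp: simple_path_def walk_def)
      moreover have "hd (l @ [v]) = p"
        using lE by (simp add: simple_path_def walk_def)
      ultimately have "graph_cycle V E (l @ [v])"
        using pv(1) by (auto simp: graph_cycle_def insert_commute)
      then show False using acyclic by blast
    qed
    \<comment> \<open>Members of \<open>subtrees\<close> carry all edges that \<open>E\<close>
      induces, so adding \<open>v\<close> must bring in a single new edge; this is where
      \<open>only\<close> enters.\<close>
    have "{e \<in> E. e \<subseteq> insert v W} = insert {p, v} {e \<in> E. e \<subseteq> W}"
    proof (intro equalityI subsetI)
      fix e assume e: "e \<in> {e \<in> E. e \<subseteq> insert v W}"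
      show "e \<in> insert {p, v} {e \<in> E. e \<subseteq> W}"
      proof (cases "v \<in> e")
        case True
        obtain a b where "e = {a, b}" "a \<noteq> b" using edge[of e] e by (auto simp: card_2_iff)
        then obtain q where "e = {q, v}" "q \<noteq> v" using True by blast
        then show ?thesis using only[of q] e by auto
      qed (use e in auto)
    qed (use pv in auto)
    then have "insert v W \<in> subtrees"
      using rooted_tree_add_leaf[OF rt pv(2,3)] vV WV by (simp add: subtrees_def)
    then show False using maximal[of "insert v W"] pv(3) by blast
  qed
  moreover have "{e \<in> E. e \<subseteq> V} = E" using edge by auto
  ultimately show ?thesis using rt by simp
qed

text \<open>The only edge between the two sides is \<open>{r, c}\<close>. A simple path that starts
  at \<open>r\<close> can use it only as its first step, because it never comes back to
  \<open>r\<close>.\<close>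

lemma simple_path_join_cases:
  assumes t1: "rooted_tree V\<^sub>1 E\<^sub>1 r" and t2: "rooted_tree V\<^sub>2 E\<^sub>2 c" and disj: "V\<^sub>1 \<inter> V\<^sub>2 = {}"
    and p: "simple_path (V\<^sub>1 \<union> V\<^sub>2) (insert {r, c} (E\<^sub>1 \<union> E\<^sub>2)) r p v"
  shows "simple_path V\<^sub>1 E\<^sub>1 r p v \<or> (\<exists>q. p = r # q \<and> simple_path V\<^sub>2 E\<^sub>2 c q v)"
proof -
  let ?E = "insert {r, c} (E\<^sub>1 \<union> E\<^sub>2)"
  have r: "r \<in> V\<^sub>1" "r \<notin> V\<^sub>2" and c: "c \<in> V\<^sub>2" "c \<notin> V\<^sub>1"
    using rooted_tree_root[OF t1] rooted_tree_root[OF t2] disj by auto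
  have E1: "x \<in> V\<^sub>1 \<and> y \<in> V\<^sub>1" if "{x, y} \<in> E\<^sub>1" for x y
    using rooted_tree_edges_subset[OF t1] that by auto
  have E2: "x \<in> V\<^sub>2 \<and> y \<in> V\<^sub>2" if "{x, y} \<in> E\<^sub>2" for x y
    using rooted_tree_edges_subset[OF t2] that by auto
  have in1: "{x, y} \<in> E\<^sub>1" if "{x, y} \<in> ?E" "x \<in> V\<^sub>1" "y \<in> V\<^sub>1" for x y
    using that r c E2[of x y] disj by (auto simp: doubleton_eq_iff)
  have in2: "{x, y} \<in> E\<^sub>2" if "{x, y} \<in> ?E" "x \<in> V\<^sub>2" "y \<in> V\<^sub>2" for x y
    using that r c E1[of x y] disj by (auto simp: doubleton_eq_iff)
  obtain q where q: "p = r # q" using p by (cases p) (auto simp: simple_path_def walk_def)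
  have succ: "successively (\<lambda>x y. {x, y} \<in> ?E) p" and dist: "distinct p"
    and last: "last p = v" using p by (auto simp: simple_path_def walk_def)
  have restrict1: "simple_path V\<^sub>1 E\<^sub>1 r p v" if "set p \<subseteq> V\<^sub>1"
  proof -
    have "successively (\<lambda>x y. {x, y} \<in> E\<^sub>1) p"
      using succ by (rule successively_mono) (use in1 that in blast)+
    then show ?thesis using that q dist last by (simp add: simple_path_def walk_def)
  qed
  show ?thesis
  proof (cases q)
    case Nil
    then show ?thesis using restrict1 q r by simp
  next
    case (Cons y q')
    \<comment> \<open>Since \<open>r\<close> does not occur in \<open>q\<close>, the rest of the
      path cannot use the edge \<open>{r, c}\<close> and stays on the side of its first vertex
      \<open>y\<close>.\<close>
    have succq: "successively (\<lambda>x y. {x, y} \<in> ?E) q" and ry: "{r, y} \<in> ?E" and rq: "r \<notin> set q"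
      using succ q Cons dist by auto
    show ?thesis
    proof (cases "y \<in> V\<^sub>1")
      case True
      have "set q \<subseteq> V\<^sub>1"
        using succq
      proof (rule successively_set_subset)
        fix a b assume "{a, b} \<in> ?E" "a \<in> set q" "b \<in> set q" "a \<in> V\<^sub>1"
        then show "b \<in> V\<^sub>1" using rq c E1[of a b] E2[of a b] disj by (auto simp: doubleton_eq_iff)
      qed (use Cons True in auto)
      then show ?thesis using restrict1 q r by simp
    next
      case False
      then have y: "y = c" using ry E1[of r y] E2[of r y] r by (auto simp: doubleton_eq_iff)
      have sub: "set q \<subseteq> V\<^sub>2"
        using succq
      proof (rule successively_set_subset)
        fix a b assume "{a, b} \<in> ?E" "a \<in> set q" "b \<in> set q" "a \<in> V\<^sub>2"
        then show "b \<in> V\<^sub>2" using rq c E1[of a b] E2[of a b] disj by (auto simp: doubleton_eq_iff)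
      qed (use Cons y c in auto)
      have "successively (\<lambda>x y. {x, y} \<in> E\<^sub>2) q"
        using succq by (rule successively_mono) (use in2 sub in blast)+
      then have "simple_path V\<^sub>2 E\<^sub>2 c q v"
        using sub dist last q Cons y by (simp add: simple_path_def walk_def)
      then show ?thesis using q by blast
    qed
  qed
qed

lemma simple_path_last_in: "simple_path V E u p v \<Longrightarrow> v \<in> V"
  by (auto simp: simple_path_def walk_def)

text \<open>The endpoint \<open>v\<close> lies in just one of the two sides, so both paths fall
  under the same case of \<open>simple_path_join_cases\<close> and the induction hypothesis for that
  side applies.\<close>

lemma rooted_tree_simple_path_unique:
  "rooted_tree V E r \<Longrightarrow> simple_path V E r p v \<Longrightarrow> simple_path V E r q v \<Longrightarrow> p = q"
proof (induction arbitrary: p q rule: rooted_tree.induct)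
  case (singleton r)
  have "p = [r]" if "simple_path {r} {} r p v" for p
    using that by (cases p; cases "tl p") (auto simp: simple_path_def walk_def)
  then show ?case using singleton by blast
next
  case (join V\<^sub>1 E\<^sub>1 r V\<^sub>2 E\<^sub>2 c)
  show ?case
    using simple_path_join_cases[OF join.hyps join.prems(1)]
      simple_path_join_cases[OF join.hyps join.prems(2)] join.IH join.hyps(3)
    by (blast dest: simple_path_last_in)
qed

lemma path_edges_eq:
  assumes "rooted_tree V E r" "simple_path V E r p v"
  shows "path_edges V E r v = edges_of p"
  unfolding path_edges_def
  using the_equality[of "\<lambda>p. simple_path V E r p v", OF assms(2)]
    rooted_tree_simple_path_unique[OF assms(1) _ assms(2)] by simp

section \<open>Edge sets of root paths under joining\<close>

lemma edges_of_Cons: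
  assumes "q \<noteq> []"
  shows "edges_of (x # q) = insert {x, hd q} (edges_of q)"
proof -
  have "edges_of (x # q) = (\<lambda>i. {(x # q) ! i, (x # q) ! Suc i}) ` {i. Suc i < length (x # q)}"
    by (auto simp: edges_of_def)
  also have "{i. Suc i < length (x # q)} = insert 0 (Suc ` {i. Suc i < length q})"
  proof (intro equalityI subsetI)
    fix i assume "i \<in> {i. Suc i < length (x # q)}"
    then show "i \<in> insert 0 (Suc ` {i. Suc i < length q})" by (cases i) auto
  qed (use assms in auto)
  also have "(\<lambda>i. {(x # q) ! i, (x # q) ! Suc i}) ` \<dots> = insert {x, hd q} (edges_of q)"
    using assms by (simp add: edges_of_def hd_conv_nth image_image setcompr_eq_image)
  finally show ?thesis .
qed

lemma edges_of_subset: "e \<in> edges_of p \<Longrightarrow> e \<subseteq> set p"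
  by (auto simp: edges_of_def)

lemma finite_edges_of: "finite (edges_of p)"
  by (rule finite_subset[of _ "Pow (set p)"]) (use edges_of_subset in auto)

lemma path_edges_join_left:
  assumes "rooted_tree V\<^sub>1 E\<^sub>1 r" "rooted_tree V\<^sub>2 E\<^sub>2 c" "V\<^sub>1 \<inter> V\<^sub>2 = {}" "v \<in> V\<^sub>1"
  shows "path_edges (V\<^sub>1 \<union> V\<^sub>2) (insert {r, c} (E\<^sub>1 \<union> E\<^sub>2)) r v = path_edges V\<^sub>1 E\<^sub>1 r v"
proof -
  obtain p where p: "simple_path V\<^sub>1 E\<^sub>1 r p v"
    using rooted_tree_ex_simple_path[OF assms(1) rooted_tree_root[OF assms(1)] assms(4)] by blast
  then have "simple_path (V\<^sub>1 \<union> V\<^sub>2) (insert {r, c} (E\<^sub>1 \<union> E\<^sub>2)) r p v"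
    by (rule simple_path_mono) auto
  then show ?thesis
    using path_edges_eq[OF assms(1) p] path_edges_eq[OF rooted_tree.join[OF assms(1-3)]] by simp
qed

text \<open>The path to \<open>v\<close> begins with the new edge. The last two facts allow the
  product of influences along it to be split into the factor of \<open>{r, c}\<close> and the
  product inside the child tree.\<close>

lemma path_edges_join_right:
  assumes "rooted_tree V\<^sub>1 E\<^sub>1 r" "rooted_tree V\<^sub>2 E\<^sub>2 c" "V\<^sub>1 \<inter> V\<^sub>2 = {}" "v \<in> V\<^sub>2"
  shows "path_edges (V\<^sub>1 \<union> V\<^sub>2) (insert {r, c} (E\<^sub>1 \<union> E\<^sub>2)) r v = insert {r, c} (path_edges V\<^sub>2 E\<^sub>2 c v)"
    and "{r, c} \<notin> path_edges V\<^sub>2 E\<^sub>2 c v" and "finite (path_edges V\<^sub>2 E\<^sub>2 c v)"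
proof -
  let ?V = "V\<^sub>1 \<union> V\<^sub>2" and ?E = "insert {r, c} (E\<^sub>1 \<union> E\<^sub>2)"
  obtain q where q: "simple_path V\<^sub>2 E\<^sub>2 c q v"
    using rooted_tree_ex_simple_path[OF assms(2) rooted_tree_root[OF assms(2)] assms(4)] by blast
  then have qV: "set q \<subseteq> V\<^sub>2" "q \<noteq> []" "hd q = c" by (auto simp: simple_path_def walk_def)
  have r: "r \<in> V\<^sub>1" "r \<notin> V\<^sub>2" using rooted_tree_root[OF assms(1)] assms(3) by auto
  have "simple_path ?V ?E c q v"
    using q by (rule simple_path_mono) auto
  then have "simple_path ?V ?E r ([r] @ q) v"
    using r qV by (intro simple_path_append[of _ _ _ _ r c]) (auto simp: simple_path_def walk_def)
  then have "path_edges ?V ?E r v = edges_of (r # q)"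
    using path_edges_eq[OF rooted_tree.join[OF assms(1-3)]] by simp
  moreover have eq: "path_edges V\<^sub>2 E\<^sub>2 c v = edges_of q"
    using path_edges_eq[OF assms(2) q] .
  ultimately show "path_edges ?V ?E r v = insert {r, c} (path_edges V\<^sub>2 E\<^sub>2 c v)"
    using edges_of_Cons[OF qV(2), of r] qV by simp
  show "{r, c} \<notin> path_edges V\<^sub>2 E\<^sub>2 c v"
    using eq edges_of_subset[of "{r, c}" q] qV r by auto
  show "finite (path_edges V\<^sub>2 E\<^sub>2 c v)"
    using eq finite_edges_of by simp
qed

section \<open>Spin configurations and restricted partition functions\<close>

lemma bij_betw_configs_Un:
  assumes "A \<inter> B = {}"
  shows "bij_betw (\<lambda>\<sigma>. (restrict \<sigma> A, restrict \<sigma> B)) (configs (A \<union> B)) (configs A \<times> configs B)"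
proof (rule bij_betw_byWitness[where f' = "\<lambda>(a, b). \<lambda>v\<in>A \<union> B. if v \<in> A then a v else b v"])
  show "\<forall>\<sigma>\<in>configs (A \<union> B). (\<lambda>(a, b). \<lambda>v\<in>A \<union> B. if v \<in> A then a v else b v)
      (restrict \<sigma> A, restrict \<sigma> B) = \<sigma>"
    by (auto simp: configs_def fun_eq_iff restrict_def PiE_def extensional_def)
  show "\<forall>x\<in>configs A \<times> configs B. (restrict ((\<lambda>(a, b). \<lambda>v\<in>A \<union> B. if v \<in> A then a v else b v) x) A,
      restrict ((\<lambda>(a, b). \<lambda>v\<in>A \<union> B. if v \<in> A then a v else b v) x) B) = x"
    using assms by (fastforce simp: configs_def fun_eq_iff restrict_def PiE_def extensional_def)
qed (auto simp: configs_def PiE_def Pi_def split: if_splits)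

lemma sum_configs_Un:
  assumes "A \<inter> B = {}"
  shows "(\<Sum>\<sigma>\<in>configs (A \<union> B). g (restrict \<sigma> A) (restrict \<sigma> B)) = (\<Sum>a\<in>configs A. \<Sum>b\<in>configs B. g a b)"
  using sum.reindex_bij_betw[OF bij_betw_configs_Un[OF assms], of "\<lambda>(a, b). g a b"]
  by (simp add: sum.cartesian_product)

section \<open>The global spin flip and sums with prescribed spins\<close>

definition flip :: "'a set \<Rightarrow> ('a \<Rightarrow> int) \<Rightarrow> 'a \<Rightarrow> int" where
  "flip A \<sigma> = (\<lambda>v\<in>A. - \<sigma> v)"

lemma flip_in_configs: "\<sigma> \<in> configs A \<Longrightarrow> flip A \<sigma> \<in> configs A"
  by (auto simp: flip_def configs_def PiE_def Pi_def)

lemma flip_flip: "\<sigma> \<in> configs A \<Longrightarrow> flip A (flip A \<sigma>) = \<sigma>"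
  by (auto simp: flip_def configs_def PiE_def extensional_def fun_eq_iff)

lemma bij_betw_flip: "bij_betw (flip A) (configs A) (configs A)"
  by (rule bij_betw_byWitness[where f' = "flip A"]) (auto simp: flip_flip flip_in_configs)

lemma restrict_in_configs: "\<sigma> \<in> configs V \<Longrightarrow> S \<subseteq> V \<Longrightarrow> restrict \<sigma> S \<in> configs S"
  by (auto simp: configs_def PiE_def Pi_def)

lemma restrict_flip: "S \<subseteq> V \<Longrightarrow> restrict (flip V \<sigma>) S = flip S (restrict \<sigma> S)"
  by (auto simp: flip_def fun_eq_iff restrict_def)

text \<open>Weights see only whether endpoints agree. Comparing agreements instead of values covers
  both the global flip and the restriction to a vertex set.\<close>

lemma gibbs_weight_cong:
  assumes "\<And>e u w. e \<in> E \<Longrightarrow> u \<in> e \<Longrightarrow> w \<in> e \<Longrightarrow> \<sigma> u = \<sigma> w \<longleftrightarrow> \<tau> u = \<tau> w"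
  shows "gibbs_weight E \<beta> J \<sigma> = gibbs_weight E \<beta> J \<tau>"
proof -
  have "(\<forall>u\<in>e. \<forall>w\<in>e. \<sigma> u = \<sigma> w) \<longleftrightarrow> (\<forall>u\<in>e. \<forall>w\<in>e. \<tau> u = \<tau> w)" if "e \<in> E" for e
    using assms[OF that] by blast
  then show ?thesis
    unfolding gibbs_weight_def by (auto intro!: sum.cong)
qed

text \<open>Left unnormalised so that joining trees gives exact products; division by
  \<open>root_sum\<close> yields the conditional law, see
  \<open>pmf_marginal_given_spin\<close>.\<close>

definition spin_sum ::
  "'a set \<Rightarrow> 'a set set \<Rightarrow> real \<Rightarrow> ('a set \<Rightarrow> real) \<Rightarrow> 'a \<Rightarrow> int \<Rightarrow> 'a set \<Rightarrow> ('a \<Rightarrow> int) \<Rightarrow> real" where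
  "spin_sum V E \<beta> J r s S \<tau> =
     (\<Sum>\<sigma>\<in>configs V. of_bool (\<sigma> r = s \<and> restrict \<sigma> S = \<tau>) * gibbs_weight E \<beta> J \<sigma>)"

definition root_sum ::
  "'a set \<Rightarrow> 'a set set \<Rightarrow> real \<Rightarrow> ('a set \<Rightarrow> real) \<Rightarrow> 'a \<Rightarrow> int \<Rightarrow> real" where
  "root_sum V E \<beta> J r s = (\<Sum>\<sigma>\<in>configs V. of_bool (\<sigma> r = s) * gibbs_weight E \<beta> J \<sigma>)"

lemma gibbs_weight_pos: "gibbs_weight E \<beta> J \<sigma> > 0"
  by (simp add: gibbs_weight_def)

lemma spin_sum_nonneg: "spin_sum V E \<beta> J r s S \<tau> \<ge> 0"
  unfolding spin_sum_def by (intro sum_nonneg mult_nonneg_nonneg) (auto intro: less_imp_le[OF gibbs_weight_pos])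

lemma sum_spin_sum:
  assumes "finite V" "S \<subseteq> V"
  shows "(\<Sum>\<tau>\<in>configs S. spin_sum V E \<beta> J r s S \<tau>) = root_sum V E \<beta> J r s"
proof -
  have "(\<Sum>\<tau>\<in>configs S. of_bool (\<sigma> r = s \<and> restrict \<sigma> S = \<tau>)) = (of_bool (\<sigma> r = s) :: real)"
    if "\<sigma> \<in> configs V" for \<sigma>
    using restrict_in_configs[OF that assms(2)] finite_configs[OF finite_subset[OF assms(2,1)]]
    by (simp add: of_bool_conj sum.delta flip: sum_distrib_left)
  then show ?thesis
    unfolding spin_sum_def root_sum_def
    by (subst sum.swap) (auto simp flip: sum_distrib_right intro!: sum.cong)
qed

lemma root_sum_pos:
  assumes "finite V" "r \<in> V" "s \<in> {- 1, 1}"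
  shows "root_sum V E \<beta> J r s > 0"
proof -
  have "(\<lambda>v\<in>V. s) \<in> configs V" using assms by (auto simp: configs_def)
  moreover have "of_bool ((\<lambda>v\<in>V. s) r = s) * gibbs_weight E \<beta> J (\<lambda>v\<in>V. s) > 0"
    using assms by (simp add: gibbs_weight_pos)
  ultimately show ?thesis
    unfolding root_sum_def using assms gibbs_weight_pos[of E \<beta> J]
    by (intro sum_pos2[of _ "\<lambda>v\<in>V. s"]) (auto simp: finite_configs intro!: mult_nonneg_nonneg less_imp_le)
qed

lemma gibbs_weight_flip:
  assumes "E \<subseteq> Pow V"
  shows "gibbs_weight E \<beta> J (flip V \<sigma>) = gibbs_weight E \<beta> J \<sigma>"
  using assms by (intro gibbs_weight_cong) (auto simp: flip_def)

text \<open>Reindexing by the flip of all of \<open>V\<close> leaves the weights unchanged and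
  reverses both the root spin and the observed spins.\<close>

lemma spin_sum_flip:
  assumes "E \<subseteq> Pow V" "r \<in> V" "S \<subseteq> V" "\<tau> \<in> configs S"
  shows "spin_sum V E \<beta> J r s S (flip S \<tau>) = spin_sum V E \<beta> J r (- s) S \<tau>"
proof -
  have "spin_sum V E \<beta> J r s S (flip S \<tau>) =
      (\<Sum>\<sigma>\<in>configs V. of_bool (flip V \<sigma> r = s \<and> restrict (flip V \<sigma>) S = flip S \<tau>) * gibbs_weight E \<beta> J (flip V \<sigma>))"
    unfolding spin_sum_def by (rule sum.reindex_bij_betw[OF bij_betw_flip, symmetric])
  also have "\<dots> = spin_sum V E \<beta> J r (- s) S \<tau>"
    unfolding spin_sum_def
  proof (rule sum.cong[OF refl])
    fix \<sigma> assume \<sigma>: "\<sigma> \<in> configs V"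
    have "flip V \<sigma> r = s \<longleftrightarrow> \<sigma> r = - s" using assms by (auto simp: flip_def)
    moreover have "restrict (flip V \<sigma>) S = flip S \<tau> \<longleftrightarrow> restrict \<sigma> S = \<tau>"
      using restrict_flip[OF assms(3)] flip_flip[OF assms(4)] flip_flip[OF restrict_in_configs[OF \<sigma> assms(3)]]
      by metis
    ultimately show "of_bool (flip V \<sigma> r = s \<and> restrict (flip V \<sigma>) S = flip S \<tau>) * gibbs_weight E \<beta> J (flip V \<sigma>)
        = of_bool (\<sigma> r = - s \<and> restrict \<sigma> S = \<tau>) * gibbs_weight E \<beta> J \<sigma>"
      using gibbs_weight_flip[OF assms(1)] by simp
  qed
  finally show ?thesis .
qed

text \<open>This is the flip symmetry with no observed vertices, where \<open>spin_sum\<close>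
  carries the whole mass of \<open>root_sum\<close>.\<close>

lemma root_sum_uminus:
  assumes "finite V" "E \<subseteq> Pow V" "r \<in> V"
  shows "root_sum V E \<beta> J r (- s) = root_sum V E \<beta> J r s"
proof -
  have "root_sum V E \<beta> J r (- s) = (\<Sum>\<tau>\<in>configs {}. spin_sum V E \<beta> J r (- s) {} \<tau>)"
    using sum_spin_sum[of V "{}"] assms by simp
  also have "\<dots> = (\<Sum>\<tau>\<in>configs {}. spin_sum V E \<beta> J r s {} (flip {} \<tau>))"
    using spin_sum_flip[OF assms(2,3), of "{}"] by simp
  also have "\<dots> = (\<Sum>\<tau>\<in>configs {}. spin_sum V E \<beta> J r s {} \<tau>)"
    by (rule sum.reindex_bij_betw[OF bij_betw_flip])
  finally show ?thesis using sum_spin_sum[of V "{}"] assms by simp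
qed

section \<open>Triangular discrimination\<close>

text \<open>The Vincze--Le Cam divergence, without normalisation. At points where the denominator
  vanishes the term is 0 by the convention for division, which is the intended value for nonnegative
  \<open>F\<close> and \<open>G\<close>.\<close>

definition discrepancy :: "'b set \<Rightarrow> ('b \<Rightarrow> real) \<Rightarrow> ('b \<Rightarrow> real) \<Rightarrow> real" where
  "discrepancy A F G = (\<Sum>x\<in>A. (F x - G x)\<^sup>2 / (F x + G x))"

lemma bias_inequality:
  fixes x y :: real
  assumes "\<bar>x\<bar> \<le> 1" "\<bar>y\<bar> \<le> 1"
  shows "(x + y)\<^sup>2 / (1 + x * y) + (x - y)\<^sup>2 / (1 - x * y) \<le> 2 * (x\<^sup>2 + y\<^sup>2)"
proof -
  have x2: "x\<^sup>2 \<le> 1" "y\<^sup>2 \<le> 1" using assms by (auto simp: abs_square_le_1)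
  show ?thesis
  proof (cases "(x * y)\<^sup>2 = 1")
    \<comment> \<open>One denominator vanishes here. Both biases are then 1 or -1, and the numerator
      over that denominator vanishes as well.\<close>
    case True
    then have "x\<^sup>2 * y\<^sup>2 = 1" by (simp add: power_mult_distrib)
    then have "x\<^sup>2 = 1 \<and> y\<^sup>2 = 1"
      using x2 by (smt (verit) mult_left_le mult_right_le_one_le zero_le_power2 mult.commute)
    then show ?thesis by (auto simp: power2_eq_1_iff)
  next
    case False
    have "\<bar>x * y\<bar> \<le> 1" using assms by (simp add: abs_mult mult_le_one)
    moreover have "x * y \<noteq> 1" "x * y \<noteq> - 1" using False by auto
    ultimately have pos: "1 + x * y > 0" "1 - x * y > 0" by linarith+
    have "(x + y)\<^sup>2 / (1 + x * y) + (x - y)\<^sup>2 / (1 - x * y)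
        = ((x + y)\<^sup>2 * (1 - x * y) + (x - y)\<^sup>2 * (1 + x * y)) / ((1 + x * y) * (1 - x * y))"
      using pos by (simp add: add_frac_eq)
    also have "\<dots> \<le> 2 * (x\<^sup>2 + y\<^sup>2)"
    proof (subst pos_divide_le_eq)
      \<comment> \<open>With denominators cleared, the gap between the two sides is visibly
        nonnegative for biases of absolute value at most 1.\<close>
      have "2 * (x\<^sup>2 + y\<^sup>2) * ((1 + x * y) * (1 - x * y))
          - ((x + y)\<^sup>2 * (1 - x * y) + (x - y)\<^sup>2 * (1 + x * y)) = 2 * (x * y)\<^sup>2 * ((1 - x\<^sup>2) + (1 - y\<^sup>2))"
        by algebra
      also have "\<dots> \<ge> 0" using x2 by simp
      finally show "(x + y)\<^sup>2 * (1 - x * y) + (x - y)\<^sup>2 * (1 + x * y)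
          \<le> 2 * (x\<^sup>2 + y\<^sup>2) * ((1 + x * y) * (1 - x * y))" by linarith
    qed (use pos in simp)
    finally show ?thesis .
  qed
qed

text \<open>The second term on the left has \<open>c\<close> and \<open>d\<close> exchanged: it
  belongs to the flipped partner of the point with masses \<open>c\<close> and \<open>d\<close>.
  Only the sum of the two terms is controlled by \<open>bias_inequality\<close>.\<close>

lemma product_discrepancy_pointwise:
  fixes a b c d :: real
  assumes "a \<ge> 0" "b \<ge> 0" "c \<ge> 0" "d \<ge> 0"
  shows "(a * c - b * d)\<^sup>2 / (a * c + b * d) + (a * d - b * c)\<^sup>2 / (a * d + b * c)
    \<le> (a - b)\<^sup>2 / (a + b) * (c + d) + (a + b) * ((c - d)\<^sup>2 / (c + d))"
proof (cases "a + b = 0 \<or> c + d = 0")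
  case True
  then have "a = 0 \<and> b = 0 \<or> c = 0 \<and> d = 0" using assms by linarith
  then show ?thesis by auto
next
  case False
  \<comment> \<open>Each pair of masses is written as its mean times one plus or minus its bias; the
    means then factor out of every quotient.\<close>
  define x y m n where "x = (a - b) / (a + b)" and "y = (c - d) / (c + d)"
    and "m = (a + b) / 2" and "n = (c + d) / 2"
  have pos: "m > 0" "n > 0" using False assms by (auto simp: m_def n_def)
  have ab: "a = m * (1 + x)" "b = m * (1 - x)" and cd: "c = n * (1 + y)" "d = n * (1 - y)"
    using False by (simp_all add: x_def y_def m_def n_def field_simps)
  have le: "\<bar>x\<bar> \<le> 1" "\<bar>y\<bar> \<le> 1"
    using assms by (auto simp: x_def y_def abs_le_iff divide_le_eq field_simps)
  \<comment> \<open>The case \<open>w = 0\<close> is included, because \<open>1 + x * y\<close> or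
    \<open>1 - x * y\<close> may vanish.\<close>
  have frac: "(2 * m * n * z)\<^sup>2 / (2 * m * n * w) = 2 * m * n * (z\<^sup>2 / w)" for z w
    using pos by (cases "w = 0") (simp_all add: field_simps power2_eq_square)
  have "a * c - b * d = 2 * m * n * (x + y)" "a * c + b * d = 2 * m * n * (1 + x * y)"
    "a * d - b * c = 2 * m * n * (x - y)" "a * d + b * c = 2 * m * n * (1 - x * y)"
    unfolding ab cd by (simp_all add: algebra_simps)
  then have "(a * c - b * d)\<^sup>2 / (a * c + b * d) + (a * d - b * c)\<^sup>2 / (a * d + b * c)
      = 2 * m * n * ((x + y)\<^sup>2 / (1 + x * y) + (x - y)\<^sup>2 / (1 - x * y))"
    by (simp only: frac) (simp only: distrib_left)
  also have "\<dots> \<le> 2 * m * n * (2 * (x\<^sup>2 + y\<^sup>2))"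
    using bias_inequality[OF le] pos by (intro mult_left_mono) auto
  also have "\<dots> = (a - b)\<^sup>2 / (a + b) * (c + d) + (a + b) * ((c - d)\<^sup>2 / (c + d))"
    unfolding ab cd using pos by (simp add: field_simps power2_eq_square)
  finally show ?thesis .
qed

text \<open>The symmetry \<open>i\<close> lets the term at \<open>y\<close> be averaged with the term at \<open>i y\<close>.\<close>

lemma discrepancy_product_le:
  assumes nonneg: "\<And>x. F\<^sub>1 x \<ge> 0" "\<And>x. G\<^sub>1 x \<ge> 0" "\<And>y. F\<^sub>2 y \<ge> 0" "\<And>y. G\<^sub>2 y \<ge> 0"
    and i: "bij_betw i B B" "\<And>y. y \<in> B \<Longrightarrow> F\<^sub>2 (i y) = G\<^sub>2 y" "\<And>y. y \<in> B \<Longrightarrow> G\<^sub>2 (i y) = F\<^sub>2 y"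
    and eq: "sum F\<^sub>1 A = sum G\<^sub>1 A"
  shows "(\<Sum>x\<in>A. \<Sum>y\<in>B. (F\<^sub>1 x * F\<^sub>2 y - G\<^sub>1 x * G\<^sub>2 y)\<^sup>2 / (F\<^sub>1 x * F\<^sub>2 y + G\<^sub>1 x * G\<^sub>2 y))
    \<le> discrepancy A F\<^sub>1 G\<^sub>1 * sum F\<^sub>2 B + sum F\<^sub>1 A * discrepancy B F\<^sub>2 G\<^sub>2"
proof -
  let ?t = "\<lambda>x y. (F\<^sub>1 x * F\<^sub>2 y - G\<^sub>1 x * G\<^sub>2 y)\<^sup>2 / (F\<^sub>1 x * F\<^sub>2 y + G\<^sub>1 x * G\<^sub>2 y)"
  let ?u = "\<lambda>x y. (F\<^sub>1 x * G\<^sub>2 y - G\<^sub>1 x * F\<^sub>2 y)\<^sup>2 / (F\<^sub>1 x * G\<^sub>2 y + G\<^sub>1 x * F\<^sub>2 y)"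
  have tu: "(\<Sum>y\<in>B. ?t x y) = (\<Sum>y\<in>B. ?u x y)" for x
    using sum.reindex_bij_betw[OF i(1), of "?t x"] i(2,3) by (simp cong: sum.cong)
  have FG: "sum F\<^sub>2 B = sum G\<^sub>2 B"
    using sum.reindex_bij_betw[OF i(1), of F\<^sub>2] i(2) by (simp cong: sum.cong)
  have "2 * (\<Sum>x\<in>A. \<Sum>y\<in>B. ?t x y) = (\<Sum>x\<in>A. (\<Sum>y\<in>B. ?t x y) + (\<Sum>y\<in>B. ?u x y))"
    by (simp add: sum_distrib_left tu)
  also have "\<dots> = (\<Sum>x\<in>A. \<Sum>y\<in>B. ?t x y + ?u x y)"
    by (simp add: sum.distrib)
  also have "\<dots> \<le> (\<Sum>x\<in>A. \<Sum>y\<in>B. (F\<^sub>1 x - G\<^sub>1 x)\<^sup>2 / (F\<^sub>1 x + G\<^sub>1 x) * (F\<^sub>2 y + G\<^sub>2 y)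
      + (F\<^sub>1 x + G\<^sub>1 x) * ((F\<^sub>2 y - G\<^sub>2 y)\<^sup>2 / (F\<^sub>2 y + G\<^sub>2 y)))"
    by (intro sum_mono product_discrepancy_pointwise nonneg)
  also have "\<dots> = discrepancy A F\<^sub>1 G\<^sub>1 * (\<Sum>y\<in>B. F\<^sub>2 y + G\<^sub>2 y) + (\<Sum>x\<in>A. F\<^sub>1 x + G\<^sub>1 x) * discrepancy B F\<^sub>2 G\<^sub>2"
    unfolding discrepancy_def sum_product sum.distrib[symmetric] ..
  \<comment> \<open>Both pairs have equal total masses, so each sum of \<open>F + G\<close> is twice
    a sum of \<open>F\<close>, and the 2 from the averaging cancels.\<close>
  also have "\<dots> = 2 * (discrepancy A F\<^sub>1 G\<^sub>1 * sum F\<^sub>2 B + sum F\<^sub>1 A * discrepancy B F\<^sub>2 G\<^sub>2)"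
    by (simp add: sum.distrib FG eq)
  finally show ?thesis by simp
qed

text \<open>Termwise, the difference of two nonnegative numbers is at most their sum in absolute
  value. This trivial bound serves for a single observed root.\<close>

lemma discrepancy_le_sum:
  assumes "\<And>x. F x \<ge> 0" "\<And>x. G x \<ge> 0"
  shows "discrepancy A F G \<le> sum F A + sum G A"
  unfolding discrepancy_def sum.distrib[symmetric]
proof (rule sum_mono)
  fix x
  have "(F x - G x)\<^sup>2 \<le> (F x + G x)\<^sup>2"
    using assms[of x] by (simp add: power2_eq_square algebra_simps)
  then show "(F x - G x)\<^sup>2 / (F x + G x) \<le> F x + G x"
    using assms[of x] by (cases "F x + G x = 0") (auto simp: pos_divide_le_eq power2_eq_square)
qed

text \<open>With \<open>e\<close> the exponential of the coupling, crossing an edge sends the pair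
  \<open>F\<close>, \<open>G\<close> to \<open>e * F + G\<close>, \<open>e * G + F\<close>.
  Differences are scaled by \<open>e - 1\<close> and sums by \<open>e + 1\<close>.\<close>

lemma discrepancy_channel:
  "discrepancy A (\<lambda>x. e * F x + G x) (\<lambda>x. e * G x + F x) = (e - 1)\<^sup>2 / (e + 1) * discrepancy A F G"
proof -
  have "(e * F x + G x - (e * G x + F x))\<^sup>2 / (e * F x + G x + (e * G x + F x))
      = (e - 1)\<^sup>2 / (e + 1) * ((F x - G x)\<^sup>2 / (F x + G x))" for x
  proof -
    have "e * F x + G x - (e * G x + F x) = (e - 1) * (F x - G x)"
      "e * F x + G x + (e * G x + F x) = (e + 1) * (F x + G x)"
      by (simp_all add: algebra_simps)
    then show ?thesis by (simp only: power_mult_distrib times_divide_times_eq)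
  qed
  then show ?thesis by (simp add: discrepancy_def sum_distrib_left)
qed

lemma sum_abs_diff_le_discrepancy:
  assumes "\<And>x. F x \<ge> 0" "\<And>x. G x \<ge> 0"
  shows "(\<Sum>x\<in>A. \<bar>F x - G x\<bar>)\<^sup>2 \<le> discrepancy A F G * (sum F A + sum G A)"
proof -
  \<comment> \<open>Where \<open>F x + G x = 0\<close>, nonnegativity makes both values 0, so the
    splitting survives the division by zero.\<close>
  have "\<bar>F x - G x\<bar> = \<bar>F x - G x\<bar> / sqrt (F x + G x) * sqrt (F x + G x)" for x
    using assms[of x] by (cases "F x + G x = 0") auto
  then have "(\<Sum>x\<in>A. \<bar>F x - G x\<bar>)\<^sup>2 = (\<Sum>x\<in>A. \<bar>F x - G x\<bar> / sqrt (F x + G x) * sqrt (F x + G x))\<^sup>2"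
    by presburger
  also have "\<dots> \<le> (\<Sum>x\<in>A. (\<bar>F x - G x\<bar> / sqrt (F x + G x))\<^sup>2) * (\<Sum>x\<in>A. (sqrt (F x + G x))\<^sup>2)"
    by (rule Cauchy_Schwarz_ineq_sum)
  also have "\<dots> = discrepancy A F G * (sum F A + sum G A)"
    using assms by (simp add: discrepancy_def power_divide sum.distrib)
  finally show ?thesis .
qed

section \<open>The bound on rooted trees\<close>

text \<open>The edges of the two sides and the new edge are distinct, so the exponent splits.
  Evaluating the weights at restrictions prepares the factorisation by
  \<open>sum_configs_Un\<close>.\<close>

lemma gibbs_weight_join:
  assumes t1: "rooted_tree V\<^sub>1 E\<^sub>1 r" and t2: "rooted_tree V\<^sub>2 E\<^sub>2 c" and disj: "V\<^sub>1 \<inter> V\<^sub>2 = {}"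
  shows "gibbs_weight (insert {r, c} (E\<^sub>1 \<union> E\<^sub>2)) \<beta> J \<sigma> =
    gibbs_weight E\<^sub>1 \<beta> J (restrict \<sigma> V\<^sub>1) * gibbs_weight E\<^sub>2 \<beta> J (restrict \<sigma> V\<^sub>2)
      * exp (\<beta> * J {r, c} * of_bool (\<sigma> r = \<sigma> c))"
proof -
  have r: "r \<in> V\<^sub>1" "r \<notin> V\<^sub>2" and c: "c \<in> V\<^sub>2" "c \<notin> V\<^sub>1"
    using rooted_tree_root[OF t1] rooted_tree_root[OF t2] disj by auto
  have new: "{r, c} \<notin> E\<^sub>1 \<union> E\<^sub>2"
    using rooted_tree_edges_subset[OF t1] rooted_tree_edges_subset[OF t2] r c by blast
  have "E\<^sub>1 \<inter> E\<^sub>2 = {}"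
  proof (rule ccontr)
    assume "E\<^sub>1 \<inter> E\<^sub>2 \<noteq> {}"
    then obtain e where e: "e \<in> E\<^sub>1" "e \<in> E\<^sub>2" by blast
    then have "e \<subseteq> V\<^sub>1 \<inter> V\<^sub>2"
      using rooted_tree_edges_subset[OF t1] rooted_tree_edges_subset[OF t2] by blast
    moreover have "card e = 2"
      using rooted_tree_simple_graph[OF t1] e by (simp add: simple_graph_def)
    ultimately show False using disj by simp
  qed
  then have "(\<Sum>e\<in>insert {r, c} (E\<^sub>1 \<union> E\<^sub>2). f e) = f {r, c} + (sum f E\<^sub>1 + sum f E\<^sub>2)" for f :: "'a set \<Rightarrow> real"
    using new rooted_tree_finite_edges[OF t1] rooted_tree_finite_edges[OF t2]
    by (simp add: sum.union_disjoint)
  moreover have "(\<forall>u\<in>{r, c}. \<forall>w\<in>{r, c}. \<sigma> u = \<sigma> w) \<longleftrightarrow> \<sigma> r = \<sigma> c"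
    by auto
  ultimately have "gibbs_weight (insert {r, c} (E\<^sub>1 \<union> E\<^sub>2)) \<beta> J \<sigma> =
      gibbs_weight E\<^sub>1 \<beta> J \<sigma> * gibbs_weight E\<^sub>2 \<beta> J \<sigma> * exp (\<beta> * J {r, c} * of_bool (\<sigma> r = \<sigma> c))"
    unfolding gibbs_weight_def by (simp only: distrib_left exp_add mult_ac)
  moreover have "gibbs_weight E\<^sub>1 \<beta> J \<sigma> = gibbs_weight E\<^sub>1 \<beta> J (restrict \<sigma> V\<^sub>1)"
    using rooted_tree_edges_subset[OF t1] by (intro gibbs_weight_cong) auto
  moreover have "gibbs_weight E\<^sub>2 \<beta> J \<sigma> = gibbs_weight E\<^sub>2 \<beta> J (restrict \<sigma> V\<^sub>2)"
    using rooted_tree_edges_subset[OF t2] by (intro gibbs_weight_cong) auto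
  ultimately show ?thesis by simp
qed

text \<open>Once the root spin is fixed to \<open>s\<close>, the new edge interacts with the spin of
  \<open>c\<close> alone: it contributes the exponential if that spin is \<open>s\<close> and 1 if
  it is \<open>- s\<close>. The two sides then decouple.\<close>

lemma spin_sum_join:
  assumes t1: "rooted_tree V\<^sub>1 E\<^sub>1 r" and t2: "rooted_tree V\<^sub>2 E\<^sub>2 c" and disj: "V\<^sub>1 \<inter> V\<^sub>2 = {}"
    and S: "S\<^sub>1 \<subseteq> V\<^sub>1" "S\<^sub>2 \<subseteq> V\<^sub>2" and \<tau>: "\<tau> \<in> configs (S\<^sub>1 \<union> S\<^sub>2)" and s: "s \<in> {- 1, 1}"
  shows "spin_sum (V\<^sub>1 \<union> V\<^sub>2) (insert {r, c} (E\<^sub>1 \<union> E\<^sub>2)) \<beta> J r s (S\<^sub>1 \<union> S\<^sub>2) \<tau> =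
    spin_sum V\<^sub>1 E\<^sub>1 \<beta> J r s S\<^sub>1 (restrict \<tau> S\<^sub>1)
      * (exp (\<beta> * J {r, c}) * spin_sum V\<^sub>2 E\<^sub>2 \<beta> J c s S\<^sub>2 (restrict \<tau> S\<^sub>2)
         + spin_sum V\<^sub>2 E\<^sub>2 \<beta> J c (- s) S\<^sub>2 (restrict \<tau> S\<^sub>2))"
proof -
  have r: "r \<in> V\<^sub>1" and c: "c \<in> V\<^sub>2"
    using rooted_tree_root[OF t1] rooted_tree_root[OF t2] by auto
  let ?\<tau>\<^sub>1 = "restrict \<tau> S\<^sub>1" and ?\<tau>\<^sub>2 = "restrict \<tau> S\<^sub>2"
  define g\<^sub>1 where "g\<^sub>1 a = of_bool (a r = s \<and> restrict a S\<^sub>1 = ?\<tau>\<^sub>1) * gibbs_weight E\<^sub>1 \<beta> J a" for a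
  \<comment> \<open>Here \<open>s\<close> stands for the root spin, which makes the edge factor a
    function of the second side only.\<close>
  define g\<^sub>2 where "g\<^sub>2 b = exp (\<beta> * J {r, c} * of_bool (s = b c)) *
    (of_bool (restrict b S\<^sub>2 = ?\<tau>\<^sub>2) * gibbs_weight E\<^sub>2 \<beta> J b)" for b
  have eq: "restrict \<sigma> (S\<^sub>1 \<union> S\<^sub>2) = \<tau> \<longleftrightarrow>
      restrict (restrict \<sigma> V\<^sub>1) S\<^sub>1 = ?\<tau>\<^sub>1 \<and> restrict (restrict \<sigma> V\<^sub>2) S\<^sub>2 = ?\<tau>\<^sub>2" for \<sigma>
  proof -
    have "restrict \<sigma> (S\<^sub>1 \<union> S\<^sub>2) = \<tau> \<longleftrightarrow> (\<forall>v\<in>S\<^sub>1 \<union> S\<^sub>2. \<sigma> v = \<tau> v)"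
      using \<tau> by (auto simp: configs_def PiE_def extensional_def fun_eq_iff)
    also have "\<dots> \<longleftrightarrow> restrict (restrict \<sigma> V\<^sub>1) S\<^sub>1 = ?\<tau>\<^sub>1 \<and> restrict (restrict \<sigma> V\<^sub>2) S\<^sub>2 = ?\<tau>\<^sub>2"
      using S by (auto simp: fun_eq_iff restrict_def)
    finally show ?thesis .
  qed
  have term_eq: "of_bool (\<sigma> r = s \<and> restrict \<sigma> (S\<^sub>1 \<union> S\<^sub>2) = \<tau>)
      * gibbs_weight (insert {r, c} (E\<^sub>1 \<union> E\<^sub>2)) \<beta> J \<sigma> = g\<^sub>1 (restrict \<sigma> V\<^sub>1) * g\<^sub>2 (restrict \<sigma> V\<^sub>2)" for \<sigma>
    unfolding gibbs_weight_join[OF t1 t2 disj] g\<^sub>1_def g\<^sub>2_def eq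
    using r c by (auto simp: of_bool_def)
  have "spin_sum (V\<^sub>1 \<union> V\<^sub>2) (insert {r, c} (E\<^sub>1 \<union> E\<^sub>2)) \<beta> J r s (S\<^sub>1 \<union> S\<^sub>2) \<tau> = sum g\<^sub>1 (configs V\<^sub>1) * sum g\<^sub>2 (configs V\<^sub>2)"
    unfolding spin_sum_def term_eq sum_product by (rule sum_configs_Un[OF disj])
  moreover have "sum g\<^sub>1 (configs V\<^sub>1) = spin_sum V\<^sub>1 E\<^sub>1 \<beta> J r s S\<^sub>1 ?\<tau>\<^sub>1"
    by (simp add: spin_sum_def g\<^sub>1_def)
  moreover have "sum g\<^sub>2 (configs V\<^sub>2) = exp (\<beta> * J {r, c}) * spin_sum V\<^sub>2 E\<^sub>2 \<beta> J c s S\<^sub>2 ?\<tau>\<^sub>2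
      + spin_sum V\<^sub>2 E\<^sub>2 \<beta> J c (- s) S\<^sub>2 ?\<tau>\<^sub>2"
    unfolding spin_sum_def sum_distrib_left sum.distrib[symmetric]
  proof (rule sum.cong[OF refl])
    fix b assume "b \<in> configs V\<^sub>2"
    then have "b c = 1 \<or> b c = - 1" using c by (auto simp: configs_def PiE_def Pi_def)
    then show "g\<^sub>2 b = exp (\<beta> * J {r, c}) * (of_bool (b c = s \<and> restrict b S\<^sub>2 = ?\<tau>\<^sub>2) * gibbs_weight E\<^sub>2 \<beta> J b)
        + of_bool (b c = - s \<and> restrict b S\<^sub>2 = ?\<tau>\<^sub>2) * gibbs_weight E\<^sub>2 \<beta> J b"
      using s by (auto simp: g\<^sub>2_def)
  qed
  ultimately show ?thesis by simp
qed

text \<open>The prefactor is the common mass of the two laws, counted twice. Keeping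
  \<open>S\<close> arbitrary avoids tracking depths: a level of the joined tree meets the two sides
  at different depths below their own roots.\<close>

lemma discrepancy_spin_sum_le:
  assumes "rooted_tree V E r" "S \<subseteq> V"
  shows "discrepancy (configs S) (spin_sum V E \<beta> J r 1 S) (spin_sum V E \<beta> J r (- 1) S)
    \<le> 2 * root_sum V E \<beta> J r 1 * (\<Sum>v\<in>S. \<Prod>e\<in>path_edges V E r v. (influence \<beta> J e)\<^sup>2)"
  using assms
proof (induction arbitrary: S rule: rooted_tree.induct)
  case (singleton r)
  show ?case
  proof (cases "S = {}")
    case True
    \<comment> \<open>With nothing observed, the flip symmetry makes the two laws equal.\<close>
    have "spin_sum {r} {} \<beta> J r 1 {} \<tau> = spin_sum {r} {} \<beta> J r (- 1) {} \<tau>" if "\<tau> \<in> configs {}" for \<tau>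
      using spin_sum_flip[of "{}" "{r}" r "{}" \<tau> \<beta> J 1] that
      by (simp add: configs_def flip_def restrict_def)
    then show ?thesis using True by (simp add: discrepancy_def)
  next
    case False
    then have S: "S = {r}" using singleton by auto
    have "simple_path {r} {} r [r] r" by (simp add: simple_path_def walk_def)
    from path_edges_eq[OF rooted_tree.singleton this] have path: "path_edges {r} {} r r = {}"
      by (simp add: edges_of_def)
    \<comment> \<open>The product over the empty path is 1, so the trivial bound by total mass is
      enough.\<close>
    have "discrepancy (configs S) (spin_sum {r} {} \<beta> J r 1 S) (spin_sum {r} {} \<beta> J r (- 1) S)
        \<le> root_sum {r} {} \<beta> J r 1 + root_sum {r} {} \<beta> J r (- 1)"
      using discrepancy_le_sum[of "spin_sum {r} {} \<beta> J r 1 S" "spin_sum {r} {} \<beta> J r (- 1) S" "configs S"]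
      by (simp add: spin_sum_nonneg sum_spin_sum S)
    also have "\<dots> = 2 * root_sum {r} {} \<beta> J r 1"
      using root_sum_uminus[of "{r}" "{}" r \<beta> J 1] by simp
    finally show ?thesis by (simp add: S path)
  qed
next
  case (join V\<^sub>1 E\<^sub>1 r V\<^sub>2 E\<^sub>2 c)
  note trees = join.hyps
  define S\<^sub>1 S\<^sub>2 where "S\<^sub>1 = S \<inter> V\<^sub>1" and "S\<^sub>2 = S \<inter> V\<^sub>2"
  have sub: "S\<^sub>1 \<subseteq> V\<^sub>1" "S\<^sub>2 \<subseteq> V\<^sub>2" and S: "S = S\<^sub>1 \<union> S\<^sub>2" and disj: "S\<^sub>1 \<inter> S\<^sub>2 = {}"
    using join.prems trees(3) by (auto simp: S\<^sub>1_def S\<^sub>2_def)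
  have fin: "finite V\<^sub>1" "finite V\<^sub>2" using trees by (simp_all add: rooted_tree_finite)
  have root: "r \<in> V\<^sub>1" "c \<in> V\<^sub>2" using trees by (simp_all add: rooted_tree_root)
  note edges\<^sub>1 = rooted_tree_edges_subset[OF trees(1)] and edges\<^sub>2 = rooted_tree_edges_subset[OF trees(2)]
  let ?V = "V\<^sub>1 \<union> V\<^sub>2" and ?E = "insert {r, c} (E\<^sub>1 \<union> E\<^sub>2)"
  define e where "e = exp (\<beta> * J {r, c})"
  define \<theta> where "\<theta> = influence \<beta> J {r, c}"
  define F\<^sub>1 G\<^sub>1 where "F\<^sub>1 = spin_sum V\<^sub>1 E\<^sub>1 \<beta> J r 1 S\<^sub>1" and "G\<^sub>1 = spin_sum V\<^sub>1 E\<^sub>1 \<beta> J r (- 1) S\<^sub>1"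
  define F\<^sub>2 G\<^sub>2 where "F\<^sub>2 = spin_sum V\<^sub>2 E\<^sub>2 \<beta> J c 1 S\<^sub>2" and "G\<^sub>2 = spin_sum V\<^sub>2 E\<^sub>2 \<beta> J c (- 1) S\<^sub>2"
  \<comment> \<open>The laws on \<open>S\<^sub>2\<close> given the spin of \<open>r\<close>, that
    is, after passing through the edge from \<open>c\<close> to \<open>r\<close>.\<close>
  define F\<^sub>2' G\<^sub>2' where "F\<^sub>2' = (\<lambda>y. e * F\<^sub>2 y + G\<^sub>2 y)" and "G\<^sub>2' = (\<lambda>y. e * G\<^sub>2 y + F\<^sub>2 y)"
  define N\<^sub>1 N\<^sub>2 where "N\<^sub>1 = root_sum V\<^sub>1 E\<^sub>1 \<beta> J r 1" and "N\<^sub>2 = root_sum V\<^sub>2 E\<^sub>2 \<beta> J c 1"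
  define B\<^sub>1 B\<^sub>2 where "B\<^sub>1 = (\<Sum>v\<in>S\<^sub>1. \<Prod>e\<in>path_edges V\<^sub>1 E\<^sub>1 r v. (influence \<beta> J e)\<^sup>2)"
    and "B\<^sub>2 = (\<Sum>v\<in>S\<^sub>2. \<Prod>e\<in>path_edges V\<^sub>2 E\<^sub>2 c v. (influence \<beta> J e)\<^sup>2)"
  have e: "e > 0" by (simp add: e_def)
  have N: "N\<^sub>1 \<ge> 0" "N\<^sub>2 \<ge> 0"
    using fin root by (simp_all add: N\<^sub>1_def N\<^sub>2_def less_imp_le root_sum_pos)
  have nonneg: "F\<^sub>1 x \<ge> 0" "G\<^sub>1 x \<ge> 0" "F\<^sub>2 x \<ge> 0" "G\<^sub>2 x \<ge> 0" "F\<^sub>2' x \<ge> 0" "G\<^sub>2' x \<ge> 0" for x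
    using e by (auto simp: F\<^sub>1_def G\<^sub>1_def F\<^sub>2_def G\<^sub>2_def F\<^sub>2'_def G\<^sub>2'_def spin_sum_nonneg)
  have sums: "sum F\<^sub>1 (configs S\<^sub>1) = N\<^sub>1" "sum G\<^sub>1 (configs S\<^sub>1) = N\<^sub>1"
      "sum F\<^sub>2 (configs S\<^sub>2) = N\<^sub>2" "sum G\<^sub>2 (configs S\<^sub>2) = N\<^sub>2"
    using sum_spin_sum[OF fin(1) sub(1)] sum_spin_sum[OF fin(2) sub(2)]
      root_sum_uminus[OF fin(1) edges\<^sub>1 root(1), of \<beta> J 1] root_sum_uminus[OF fin(2) edges\<^sub>2 root(2), of \<beta> J 1]
    by (simp_all add: F\<^sub>1_def G\<^sub>1_def F\<^sub>2_def G\<^sub>2_def N\<^sub>1_def N\<^sub>2_def)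
  have sum': "sum F\<^sub>2' (configs S\<^sub>2) = (e + 1) * N\<^sub>2"
    by (simp add: F\<^sub>2'_def sum.distrib sums algebra_simps flip: sum_distrib_left)
  \<comment> \<open>This is the symmetry that \<open>discrepancy_product_le\<close> asks of its
    second factor.\<close>
  have flip: "F\<^sub>2' (flip S\<^sub>2 y) = G\<^sub>2' y" "G\<^sub>2' (flip S\<^sub>2 y) = F\<^sub>2' y" if "y \<in> configs S\<^sub>2" for y
    using spin_sum_flip[OF edges\<^sub>2 root(2) sub(2) that, of \<beta> J 1] spin_sum_flip[OF edges\<^sub>2 root(2) sub(2) that, of \<beta> J "- 1"]
    by (simp_all add: F\<^sub>2'_def G\<^sub>2'_def F\<^sub>2_def G\<^sub>2_def)
  have F: "spin_sum ?V ?E \<beta> J r 1 S \<tau> = F\<^sub>1 (restrict \<tau> S\<^sub>1) * F\<^sub>2' (restrict \<tau> S\<^sub>2)"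
    and G: "spin_sum ?V ?E \<beta> J r (- 1) S \<tau> = G\<^sub>1 (restrict \<tau> S\<^sub>1) * G\<^sub>2' (restrict \<tau> S\<^sub>2)" if "\<tau> \<in> configs S" for \<tau>
    using spin_sum_join[OF trees sub that[unfolded S], of 1] spin_sum_join[OF trees sub that[unfolded S], of "- 1"]
    by (simp_all add: F\<^sub>1_def G\<^sub>1_def F\<^sub>2'_def G\<^sub>2'_def F\<^sub>2_def G\<^sub>2_def e_def S)
  have "root_sum ?V ?E \<beta> J r 1 = (\<Sum>\<tau>\<in>configs S. spin_sum ?V ?E \<beta> J r 1 S \<tau>)"
    using sum_spin_sum[of ?V S] fin join.prems by simp
  also have "\<dots> = (\<Sum>\<tau>\<in>configs (S\<^sub>1 \<union> S\<^sub>2). F\<^sub>1 (restrict \<tau> S\<^sub>1) * F\<^sub>2' (restrict \<tau> S\<^sub>2))"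
    using F S by (auto intro!: sum.cong)
  also have "\<dots> = N\<^sub>1 * ((e + 1) * N\<^sub>2)"
    unfolding sum_configs_Un[OF disj, of "\<lambda>a b. F\<^sub>1 a * F\<^sub>2' b"] by (simp add: sums sum' flip: sum_product)
  finally have root_sum: "root_sum ?V ?E \<beta> J r 1 = N\<^sub>1 * ((e + 1) * N\<^sub>2)" .
  have "(\<Sum>v\<in>S. \<Prod>e\<in>path_edges ?V ?E r v. (influence \<beta> J e)\<^sup>2)
      = (\<Sum>v\<in>S\<^sub>1. \<Prod>e\<in>path_edges ?V ?E r v. (influence \<beta> J e)\<^sup>2)
        + (\<Sum>v\<in>S\<^sub>2. \<Prod>e\<in>path_edges ?V ?E r v. (influence \<beta> J e)\<^sup>2)"
    unfolding S using fin sub disj by (intro sum.union_disjoint) (auto intro: finite_subset)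
  also have "(\<Sum>v\<in>S\<^sub>1. \<Prod>e\<in>path_edges ?V ?E r v. (influence \<beta> J e)\<^sup>2) = B\<^sub>1"
    unfolding B\<^sub>1_def using sub by (intro sum.cong refl) (simp add: path_edges_join_left[OF trees] subset_iff)
  also have "(\<Sum>v\<in>S\<^sub>2. \<Prod>e\<in>path_edges ?V ?E r v. (influence \<beta> J e)\<^sup>2) = \<theta>\<^sup>2 * B\<^sub>2"
    unfolding B\<^sub>2_def sum_distrib_left
  proof (rule sum.cong[OF refl])
    fix v assume "v \<in> S\<^sub>2"
    then have "v \<in> V\<^sub>2" using sub by blast
    then show "(\<Prod>e\<in>path_edges ?V ?E r v. (influence \<beta> J e)\<^sup>2)
        = \<theta>\<^sup>2 * (\<Prod>e\<in>path_edges V\<^sub>2 E\<^sub>2 c v. (influence \<beta> J e)\<^sup>2)"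
      using path_edges_join_right[OF trees, of v] by (simp add: \<theta>_def)
  qed
  finally have bound: "(\<Sum>v\<in>S. \<Prod>e\<in>path_edges ?V ?E r v. (influence \<beta> J e)\<^sup>2) = B\<^sub>1 + \<theta>\<^sup>2 * B\<^sub>2" .
  have "\<theta>\<^sup>2 = (e - 1)\<^sup>2 / (e + 1)\<^sup>2"
    by (simp add: \<theta>_def influence_def power_divide power2_commute[of 1 e] add.commute[of 1 e] flip: e_def)
  \<comment> \<open>The factor \<open>e + 1\<close> is the growth of the mass across the edge, see
    \<open>sum'\<close>; relative to the mass, the edge contributes exactly the squared
    influence.\<close>
  then have theta: "(e - 1)\<^sup>2 / (e + 1) = \<theta>\<^sup>2 * (e + 1)"
    using e by (simp add: power2_eq_square)
  have "discrepancy (configs S) (spin_sum ?V ?E \<beta> J r 1 S) (spin_sum ?V ?E \<beta> J r (- 1) S)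
      = (\<Sum>\<tau>\<in>configs (S\<^sub>1 \<union> S\<^sub>2).
          (F\<^sub>1 (restrict \<tau> S\<^sub>1) * F\<^sub>2' (restrict \<tau> S\<^sub>2) - G\<^sub>1 (restrict \<tau> S\<^sub>1) * G\<^sub>2' (restrict \<tau> S\<^sub>2))\<^sup>2
          / (F\<^sub>1 (restrict \<tau> S\<^sub>1) * F\<^sub>2' (restrict \<tau> S\<^sub>2) + G\<^sub>1 (restrict \<tau> S\<^sub>1) * G\<^sub>2' (restrict \<tau> S\<^sub>2)))"
    unfolding discrepancy_def using F G S by (auto intro!: sum.cong)
  also have "\<dots> = (\<Sum>a\<in>configs S\<^sub>1. \<Sum>b\<in>configs S\<^sub>2.
      (F\<^sub>1 a * F\<^sub>2' b - G\<^sub>1 a * G\<^sub>2' b)\<^sup>2 / (F\<^sub>1 a * F\<^sub>2' b + G\<^sub>1 a * G\<^sub>2' b))"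
    by (rule sum_configs_Un[OF disj])
  also have "\<dots> \<le> discrepancy (configs S\<^sub>1) F\<^sub>1 G\<^sub>1 * sum F\<^sub>2' (configs S\<^sub>2)
      + sum F\<^sub>1 (configs S\<^sub>1) * discrepancy (configs S\<^sub>2) F\<^sub>2' G\<^sub>2'"
    by (rule discrepancy_product_le[where i = "flip S\<^sub>2"]) (simp_all add: sums nonneg flip bij_betw_flip)
  also have "\<dots> = discrepancy (configs S\<^sub>1) F\<^sub>1 G\<^sub>1 * ((e + 1) * N\<^sub>2)
      + N\<^sub>1 * (\<theta>\<^sup>2 * (e + 1) * discrepancy (configs S\<^sub>2) F\<^sub>2 G\<^sub>2)"
    unfolding sum' sums unfolding F\<^sub>2'_def G\<^sub>2'_def discrepancy_channel theta ..
  also have "\<dots> \<le> 2 * N\<^sub>1 * B\<^sub>1 * ((e + 1) * N\<^sub>2) + N\<^sub>1 * (\<theta>\<^sup>2 * (e + 1) * (2 * N\<^sub>2 * B\<^sub>2))"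
    using join.IH(1)[OF sub(1)] join.IH(2)[OF sub(2)] N e
    by (intro add_mono mult_left_mono mult_right_mono)
       (simp_all add: F\<^sub>1_def G\<^sub>1_def F\<^sub>2_def G\<^sub>2_def N\<^sub>1_def N\<^sub>2_def B\<^sub>1_def B\<^sub>2_def)
  \<comment> \<open>Both terms share the factor \<open>N\<^sub>1 * ((e + 1) * N\<^sub>2)\<close>,
    the root sum of the joined tree.\<close>
  also have "\<dots> = 2 * (N\<^sub>1 * ((e + 1) * N\<^sub>2)) * (B\<^sub>1 + \<theta>\<^sup>2 * B\<^sub>2)"
    by (simp add: algebra_simps)
  finally show ?case by (simp only: root_sum bound)
qed

section \<open>Total variation and the conditional laws\<close>

lemma measure_pmf_eq_sum:
  assumes "finite C" "set_pmf p \<subseteq> C"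
  shows "measure_pmf.prob p A = (\<Sum>x\<in>C. of_bool (x \<in> A) * pmf p x)"
proof -
  have "measure_pmf.prob p A = measure_pmf.prob p (A \<inter> C)"
    by (rule measure_prob_cong_0) (use assms in \<open>auto simp: set_pmf_iff\<close>)
  also have "\<dots> = (\<Sum>x\<in>C \<inter> A. pmf p x)"
    using assms by (simp add: measure_measure_pmf_finite Int_commute)
  also have "\<dots> = (\<Sum>x\<in>C. of_bool (x \<in> A) * pmf p x)"
    using assms by (auto simp: sum.inter_restrict intro!: sum.cong)
  finally show ?thesis .
qed

lemma tv_dist_le_half_sum:
  assumes "finite C" "set_pmf p \<subseteq> C" "set_pmf q \<subseteq> C"
  shows "tv_dist p q \<le> (\<Sum>x\<in>C. \<bar>pmf p x - pmf q x\<bar>) / 2"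
  unfolding tv_dist_def
proof (rule cSUP_least)
  fix A
  have "sum (pmf p) C = 1" "sum (pmf q) C = 1"
    using assms sum_pmf_eq_1 by metis+
  then have zero: "(\<Sum>x\<in>C. (pmf p x - pmf q x) / 2) = 0"
    by (simp add: sum_subtractf flip: sum_divide_distrib)
  have "measure_pmf.prob p A - measure_pmf.prob q A = (\<Sum>x\<in>C. of_bool (x \<in> A) * (pmf p x - pmf q x))"
    using assms by (simp add: measure_pmf_eq_sum sum_subtractf algebra_simps)
  \<comment> \<open>Subtracting this zero centres the indicator: its coefficients become 1/2 or
    -1/2, which gives the factor 1/2 for every event at once.\<close>
  also have "\<dots> = (\<Sum>x\<in>C. of_bool (x \<in> A) * (pmf p x - pmf q x)) - (\<Sum>x\<in>C. (pmf p x - pmf q x) / 2)"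
    using zero by simp
  also have "\<dots> = (\<Sum>x\<in>C. (of_bool (x \<in> A) - 1 / 2) * (pmf p x - pmf q x))"
    unfolding sum_subtractf[symmetric] by (simp add: left_diff_distrib)
  also have "\<bar>\<dots>\<bar> \<le> (\<Sum>x\<in>C. \<bar>(of_bool (x \<in> A) - 1 / 2) * (pmf p x - pmf q x)\<bar>)"
    by (rule sum_abs)
  also have "\<dots> = (\<Sum>x\<in>C. \<bar>pmf p x - pmf q x\<bar> / 2)"
    by (intro sum.cong refl) (simp add: abs_mult of_bool_def)
  finally show "\<bar>measure_pmf.prob p A - measure_pmf.prob q A\<bar> \<le> (\<Sum>x\<in>C. \<bar>pmf p x - pmf q x\<bar>) / 2"
    by (simp add: sum_divide_distrib)
qed simp

lemma pmf_marginal_given_spin: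
  assumes "finite V" "r \<in> V" "s \<in> {- 1, 1}"
  shows "pmf (marginal_given_spin (gibbs V E \<beta> J) S r s) \<tau> = spin_sum V E \<beta> J r s S \<tau> / root_sum V E \<beta> J r s"
proof -
  let ?\<mu> = "gibbs V E \<beta> J" and ?Z = "partition_function V E \<beta> J" and ?N = "root_sum V E \<beta> J r s"
  note nonempty = gibbs_spin_nonempty[OF assms, of E \<beta> J]
  note Z = partition_function_pos[OF assms(1), of E \<beta> J]
  note fin = finite_configs[OF assms(1)]
  have prob: "measure_pmf.prob ?\<mu> {\<sigma>. \<sigma> r = s} = ?N / ?Z"
    unfolding root_sum_def sum_divide_distrib
    by (subst measure_pmf_eq_sum[OF fin]) (simp_all add: set_pmf_gibbs assms pmf_gibbs)
  have "pmf (marginal_given_spin ?\<mu> S r s) \<tau>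
      = measure_pmf.prob (cond_pmf ?\<mu> {\<sigma>. \<sigma> r = s}) ((\<lambda>\<sigma>. restrict \<sigma> S) -` {\<tau>})"
    unfolding marginal_given_spin_def by (rule pmf_map)
  also have "\<dots> = (\<Sum>\<sigma>\<in>configs V. of_bool (restrict \<sigma> S = \<tau>) * pmf (cond_pmf ?\<mu> {\<sigma>. \<sigma> r = s}) \<sigma>)"
    by (subst measure_pmf_eq_sum[OF fin]) (auto simp: set_cond_pmf[OF nonempty] set_pmf_gibbs assms)
  \<comment> \<open>The partition function cancels between the Gibbs mass of a configuration and the
    probability of the conditioning event.\<close>
  also have "\<dots> = (\<Sum>\<sigma>\<in>configs V. of_bool (\<sigma> r = s \<and> restrict \<sigma> S = \<tau>) * gibbs_weight E \<beta> J \<sigma> / ?N)"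
    using Z by (intro sum.cong refl) (simp add: pmf_cond[OF nonempty] prob pmf_gibbs assms)
  finally show ?thesis by (simp add: spin_sum_def sum_divide_distrib)
qed

lemma set_pmf_marginal_given_spin:
  assumes "finite V" "r \<in> V" "s \<in> {- 1, 1}" "S \<subseteq> V"
  shows "set_pmf (marginal_given_spin (gibbs V E \<beta> J) S r s) \<subseteq> configs S"
  using assms restrict_in_configs[OF _ assms(4)]
  by (auto simp: marginal_given_spin_def set_cond_pmf[OF gibbs_spin_nonempty[OF assms(1-3)]] set_pmf_gibbs)

theorem theorem5p1:
  fixes V :: "'a set" and E :: "'a set set" and r :: 'a
    and h :: nat and \<beta> :: real and J :: "'a set \<Rightarrow> real"
  assumes "h > 0" and "\<beta> > 0"
    and "finite_tree V E" and "r \<in> V" and "tree_height V E r = h"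
  defines "\<mu> \<equiv> gibbs V E \<beta> J" and "\<Lambda> \<equiv> level V E r h"
  shows "tv_dist (marginal_given_spin \<mu> \<Lambda> r 1) (marginal_given_spin \<mu> \<Lambda> r (- 1))
    \<le> sqrt (\<Sum>v\<in>\<Lambda>. \<Prod>e\<in>path_edges V E r v. (influence \<beta> J e)\<^sup>2)"
proof -
  have tree: "rooted_tree V E r"
    using assms by (intro finite_tree_imp_rooted_tree)
  have fin: "finite V" and sub: "\<Lambda> \<subseteq> V"
    using rooted_tree_finite[OF tree] by (auto simp: \<Lambda>_def level_def)
  let ?F = "spin_sum V E \<beta> J r 1 \<Lambda>" and ?G = "spin_sum V E \<beta> J r (- 1) \<Lambda>"
  define N where "N = root_sum V E \<beta> J r 1"
  define B where "B = (\<Sum>v\<in>\<Lambda>. \<Prod>e\<in>path_edges V E r v. (influence \<beta> J e)\<^sup>2)"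
  have N: "N > 0" "root_sum V E \<beta> J r (- 1) = N"
    using root_sum_pos[OF fin \<open>r \<in> V\<close>] root_sum_uminus[OF fin rooted_tree_edges_subset[OF tree] \<open>r \<in> V\<close>, of \<beta> J 1]
    by (simp_all add: N_def)
  \<comment> \<open>Both laws have mass \<open>N\<close>, so Cauchy--Schwarz and the induction bound
    together produce \<open>(2 * N)\<^sup>2\<close>. Its root \<open>2 * N\<close> is cancelled at
    the end by normalising with \<open>N\<close> and by the 1/2 in the total variation
    bound.\<close>
  have "(\<Sum>\<tau>\<in>configs \<Lambda>. \<bar>?F \<tau> - ?G \<tau>\<bar>)\<^sup>2 \<le> discrepancy (configs \<Lambda>) ?F ?G * (N + N)"
    using sum_abs_diff_le_discrepancy[of ?F ?G "configs \<Lambda>"] N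
    by (simp add: spin_sum_nonneg sum_spin_sum[OF fin sub] N_def)
  also have "\<dots> \<le> 2 * N * B * (N + N)"
    using discrepancy_spin_sum_le[OF tree sub, of \<beta> J] N by (intro mult_right_mono) (simp_all add: N_def B_def)
  also have "\<dots> = (2 * N)\<^sup>2 * B"
    by (simp add: power2_eq_square)
  finally have "(\<Sum>\<tau>\<in>configs \<Lambda>. \<bar>?F \<tau> - ?G \<tau>\<bar>) \<le> sqrt ((2 * N)\<^sup>2 * B)"
    by (rule real_le_rsqrt)
  also have "\<dots> = 2 * N * sqrt B"
    using N by (simp add: real_sqrt_mult)
  finally have le: "(\<Sum>\<tau>\<in>configs \<Lambda>. \<bar>?F \<tau> - ?G \<tau>\<bar>) \<le> 2 * N * sqrt B" .
  have "tv_dist (marginal_given_spin \<mu> \<Lambda> r 1) (marginal_given_spin \<mu> \<Lambda> r (- 1))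
      \<le> (\<Sum>\<tau>\<in>configs \<Lambda>. \<bar>?F \<tau> / N - ?G \<tau> / N\<bar>) / 2"
    using tv_dist_le_half_sum[OF finite_configs[OF finite_subset[OF sub fin]]
        set_pmf_marginal_given_spin[OF fin \<open>r \<in> V\<close> _ sub, of 1 E \<beta> J]
        set_pmf_marginal_given_spin[OF fin \<open>r \<in> V\<close> _ sub, of "- 1" E \<beta> J]]
    by (simp add: \<mu>_def pmf_marginal_given_spin[OF fin \<open>r \<in> V\<close>] N N_def[symmetric])
  also have "\<dots> = (\<Sum>\<tau>\<in>configs \<Lambda>. \<bar>?F \<tau> - ?G \<tau>\<bar>) / N / 2"
    using N by (simp add: sum_divide_distrib flip: diff_divide_distrib)
  also have "\<dots> \<le> sqrt B"
    using le N by (simp add: field_simps)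
  finally show ?thesis by (simp add: B_def)
qed

end
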